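(* Let $\beta\mathbb{N}$ be the Čech–Stone compactification of the discrete space $\mathbb{N}$, let $B$ be the closed unit ball of the dual space $C(\beta\mathbb{N})^*$ endowed with the weak* topology, and let $K=B\sqcup\beta\mathbb{N}$ be the (topological) disjoint union. Then the set of all bounded linear operators $T\colon C(K)\to C(K)$ having the Bishop property is not a right ideal of the algebra $\mathscr{B}(C(K))$ of bounded linear operators on $C(K)$.
   Context: For a compact Hausdorff space $K$, $C(K)$ is the Banach space of all scalar-valued (real or complex) continuous functions on $K$ with the supremum norm. For $f\in C(K)$, $\operatorname{supp} f$ is the closure of $\{t\in K: f(t)\neq 0\}$. For distinct $f,g\in C(K)$ write $f\prec g$ if $f$ and $g$ agree on $\operatorname{supp} f$; this is a strict partial order. A subset $F\subseteq C(K)$ is a $\prec$-chain if for all distinct $f,g\in F$ either $f\prec g$ or $g\prec f$. A bounded linear operator $T\colon C(K)\to X$ into a Banach space $X$ has the Bishop property if $\inf\{\|Tf-Tg\| : f,g\in F,\ f\prec g\}=0$ for every norm-bounded uncountable $\prec$-chain $F$ in $C(K)$. A right ideal of an algebra $\mathscr{A}$ is a linear subspace $\mathscr{J}$ such that $TR\in\mathscr{J}$ whenever $T\in\mathscr{J}$ and $R\in\mathscr{A}$; here the product in $\mathscr{B}(C(K))$ is composition, $TR=T\circ R$. *)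

theory Defs
  imports "HOL-Analysis.Analysis"
begin

section \<open>Spaces of continuous functions over a scalar field\<close>

text \<open>
  For compact \<open>K\<close>, every continuous function is bounded, so \<open>K \<Rightarrow>\<^sub>C 's\<close> is \<open>C(K)\<close> with the
  supremum norm.  The library only provides the real vector space structure; multiplication by
  scalars of \<open>'s\<close> (real or complex) is added here.  It agrees with \<open>(*\<^sub>R)\<close> when \<open>'s = real\<close>.
\<close>

definition scale_bc :: "'s \<Rightarrow> ('a \<Rightarrow>\<^sub>C 's) \<Rightarrow> ('a::topological_space \<Rightarrow>\<^sub>C 's::real_normed_field)"
  where "scale_bc c f = Bcontfun (\<lambda>x. c * f x)"

lemma apply_scale_bc [simp]: "apply_bcontfun (scale_bc c f) x = c * f x"
proof -
  have "(\<lambda>x. c * apply_bcontfun f x) \<in> bcontfun"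
  proof (rule bcontfun_normI)
    show "continuous_on UNIV (\<lambda>x. c * apply_bcontfun f x)"
      by (intro continuous_intros) auto
    show "norm (c * apply_bcontfun f x) \<le> norm c * norm f" for x
      by (simp add: norm_mult mult_left_mono norm_bounded)
  qed
  then show ?thesis
    by (simp add: scale_bc_def Bcontfun_inverse)
qed

lemma scale_bc_real: "scale_bc (c::real) f = c *\<^sub>R f"
  by (rule bcontfun_eqI) simp

definition bounded_functionals ::
    "(('a::topological_space \<Rightarrow>\<^sub>C 's::real_normed_field) \<Rightarrow> 's) set"
  where "bounded_functionals =
    {\<phi>. bounded_linear \<phi> \<and> (\<forall>c f. \<phi> (scale_bc c f) = c * \<phi> f)}"

definition bounded_operators ::
    "(('a::topological_space \<Rightarrow>\<^sub>C 's::real_normed_field) \<Rightarrow> ('a \<Rightarrow>\<^sub>C 's)) set"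
  where "bounded_operators =
    {T. bounded_linear T \<and> (\<forall>c f. T (scale_bc c f) = scale_bc c (T f))}"


section \<open>Induced topologies and compactness\<close>

lemma class_topological_space_vimage:
  "class.topological_space (\<lambda>U. \<exists>V. open V \<and> U = r -` V)"
proof
  show "\<exists>V. open V \<and> UNIV = r -` V"
    by (intro exI[of _ UNIV]) auto
  show "\<exists>V. open V \<and> S \<inter> T = r -` V"
    if "\<exists>V. open V \<and> S = r -` V" "\<exists>V. open V \<and> T = r -` V" for S T
  proof -
    from that obtain V W where "open V" "S = r -` V" "open W" "T = r -` W"
      by blast
    then show ?thesis
      by (intro exI[of _ "V \<inter> W"]) auto
  qed
  show "\<exists>V. open V \<and> \<Union>K = r -` V" if "\<forall>S\<in>K. \<exists>V. open V \<and> S = r -` V" for K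
  proof -
    from that obtain v where "\<forall>S\<in>K. open (v S) \<and> S = r -` v S"
      by (rule bchoice [THEN exE])
    then have v: "open (v S)" "x \<in> S \<longleftrightarrow> r x \<in> v S" if "S \<in> K" for S x
      using that by (blast, metis vimage_eq)
    have "\<Union>K = r -` \<Union>(v ` K)"
      using v(2) by auto
    moreover have "open (\<Union>(v ` K))"
      using v(1) by blast
    ultimately show ?thesis by blast
  qed
qed

lemma compact_UNIV_vimage:
  fixes r :: "'a::topological_space \<Rightarrow> 'b::topological_space"
  assumes r: "\<And>U. open U \<longleftrightarrow> (\<exists>V. open V \<and> U = r -` V)" and c: "compact (range r)"
  shows "compact (UNIV :: 'a set)"
proof (rule compactI)
  fix C :: "'a set set" assume C: "\<forall>S\<in>C. open S" "UNIV \<subseteq> \<Union>C"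
  then have "\<forall>S\<in>C. \<exists>V. open V \<and> S = r -` V"
    by (simp flip: r)
  then obtain v where "\<forall>S\<in>C. open (v S) \<and> S = r -` v S"
    by (rule bchoice [THEN exE])
  then have v: "open (v S)" "x \<in> S \<longleftrightarrow> r x \<in> v S" if "S \<in> C" for S x
    using that by (blast, metis vimage_eq)
  have "range r \<subseteq> \<Union>(v ` C)"
  proof
    fix y assume "y \<in> range r"
    then obtain x where x: "y = r x" by auto
    with C(2) obtain S where "S \<in> C" "x \<in> S" by auto
    then show "y \<in> \<Union>(v ` C)" using v(2)[of S] x by auto
  qed
  moreover have "\<forall>B\<in>v ` C. open B" using v(1) by auto
  ultimately obtain D where D: "D \<subseteq> v ` C" "finite D" "range r \<subseteq> \<Union>D"
    using compactE[OF c, of "v ` C"] by (metis (no_types))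
  from D(1,2) obtain C' where C': "C' \<subseteq> C" "finite C'" "D = v ` C'"
    by (meson finite_subset_image)
  have "UNIV \<subseteq> \<Union>C'"
  proof
    fix x
    from D(3) C'(3) obtain S where "S \<in> C'" "r x \<in> v S" by auto
    then show "x \<in> \<Union>C'" using v(2)[of S x] C'(1) by blast
  qed
  then show "\<exists>C'\<subseteq>C. finite C' \<and> UNIV \<subseteq> \<Union>C'"
    using C'(1,2) by (intro exI[of _ C'] conjI)
qed

lemma compact_closed_bounded_fun:
  fixes S :: "('i \<Rightarrow> 'b::heine_borel) set"
  assumes "closed S" "\<And>p i. p \<in> S \<Longrightarrow> p i \<in> K i" "\<And>i. compact (K i)"
  shows "compact S"
proof -
  have "compactin euclidean (PiE UNIV K)"
    unfolding euclidean_product_topology[symmetric] using assms(3) by (simp add: compactin_PiE)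
  then have "compact (PiE UNIV K \<inter> S)"
    using assms(1) by (intro compact_Int_closed) simp_all
  also have "PiE UNIV K \<inter> S = S"
    using assms(2) by (auto simp: PiE_def)
  finally show ?thesis .
qed


section \<open>The Stone--Cech compactification\<close>

text \<open>
  The closure of the canonical image of \<open>X\<close> in the product of copies of the real line indexed by
  all bounded continuous real functions on \<open>X\<close>, with the topology induced by the product topology.
\<close>

typedef (overloaded) 'a stone_cech =
    "closure (range (\<lambda>x::'a::topological_space. \<lambda>f::'a \<Rightarrow>\<^sub>C real. apply_bcontfun f x))"
  by (rule exI, rule subsetD[OF closure_subset], rule rangeI)

instantiation stone_cech :: (topological_space) topological_space
begin

definition open_stone_cech :: "'a stone_cech set \<Rightarrow> bool"
  where "open_stone_cech U \<longleftrightarrow> (\<exists>V. open V \<and> U = Rep_stone_cech -` V)"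

instance
proof
  note cls = class_topological_space_vimage[of Rep_stone_cech]
  show "open (UNIV :: 'a stone_cech set)"
    unfolding open_stone_cech_def by (rule topological_space.open_UNIV[OF cls])
  show "open (S \<inter> T)" if "open S" "open T" for S T :: "'a stone_cech set"
    using that unfolding open_stone_cech_def by (rule topological_space.open_Int[OF cls])
  show "open (\<Union>K)" if "\<forall>S\<in>K. open S" for K :: "'a stone_cech set set"
    using that unfolding open_stone_cech_def by (rule topological_space.open_Union[OF cls])
qed

end

instance stone_cech :: (topological_space) t2_space
proof
  fix p q :: "'a stone_cech" assume "p \<noteq> q"
  then have "Rep_stone_cech p \<noteq> Rep_stone_cech q"
    by (simp add: Rep_stone_cech_inject)
  then obtain f where f: "Rep_stone_cech p f \<noteq> Rep_stone_cech q f"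
    by auto
  then obtain U V where UV: "open U" "open V" "Rep_stone_cech p f \<in> U" "Rep_stone_cech q f \<in> V"
      "U \<inter> V = {}"
    using hausdorff[OF f] by blast
  have "open (Rep_stone_cech -` ((\<lambda>h. h f) -` W))" if "open W" for W
    unfolding open_stone_cech_def
    by (intro exI[of _ "(\<lambda>h. h f) -` W"] conjI refl
        open_vimage[OF that continuous_on_product_coordinates])
  with UV show "\<exists>U V. open U \<and> open V \<and> p \<in> U \<and> q \<in> V \<and> U \<inter> V = {}"
    by (intro exI[of _ "Rep_stone_cech -` ((\<lambda>h. h f) -` U)"]
        exI[of _ "Rep_stone_cech -` ((\<lambda>h. h f) -` V)"]) auto
qed

lemma compact_UNIV_stone_cech: "compact (UNIV :: 'a::topological_space stone_cech set)"
proof (rule compact_UNIV_vimage[OF open_stone_cech_def])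
  let ?A = "range (\<lambda>x::'a. \<lambda>f::'a \<Rightarrow>\<^sub>C real. apply_bcontfun f x)"
  let ?B = "{p. \<forall>f::'a \<Rightarrow>\<^sub>C real. norm (p f) \<le> norm f}"
  have "closed ?B"
    by (intro closed_Collect_all closed_Collect_le continuous_on_norm
        continuous_on_product_coordinates continuous_on_const)
  moreover have "?A \<subseteq> ?B"
    by (auto simp: norm_bounded simp del: real_norm_def)
  ultimately have "closure ?A \<subseteq> ?B"
    by (rule closure_minimal[rotated])
  then have "compact (closure ?A)"
    by (intro compact_closed_bounded_fun[where K = "\<lambda>f. cball 0 (norm f)"]) auto
  then show "compact (range (Rep_stone_cech :: 'a stone_cech \<Rightarrow> _))"
    by (simp add: type_definition.Rep_range[OF type_definition_stone_cech])
qed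


section \<open>The closed unit ball of the dual space with the weak* topology\<close>

typedef (overloaded) ('a, 's) dual_ball =
    "{\<phi> \<in> bounded_functionals.
        onorm (\<phi> :: ('a::topological_space \<Rightarrow>\<^sub>C 's::real_normed_field) \<Rightarrow> 's) \<le> 1}"
  by (rule exI[of _ "\<lambda>_. 0"]) (simp add: bounded_functionals_def onorm_zero)

text \<open>
  The weak* topology is the topology of pointwise convergence, i.e., it is induced by the product
  topology on functions.
\<close>

instantiation dual_ball :: (topological_space, real_normed_field) topological_space
begin

definition open_dual_ball :: "('a, 'b) dual_ball set \<Rightarrow> bool"
  where "open_dual_ball U \<longleftrightarrow> (\<exists>V. open V \<and> U = Rep_dual_ball -` V)"

instance
proof
  note cls = class_topological_space_vimage[of Rep_dual_ball]
  show "open (UNIV :: ('a, 'b) dual_ball set)"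
    unfolding open_dual_ball_def by (rule topological_space.open_UNIV[OF cls])
  show "open (S \<inter> T)" if "open S" "open T" for S T :: "('a, 'b) dual_ball set"
    using that unfolding open_dual_ball_def by (rule topological_space.open_Int[OF cls])
  show "open (\<Union>K)" if "\<forall>S\<in>K. open S" for K :: "('a, 'b) dual_ball set set"
    using that unfolding open_dual_ball_def by (rule topological_space.open_Union[OF cls])
qed

end

instance dual_ball :: (topological_space, real_normed_field) t2_space
proof
  fix p q :: "('a, 'b) dual_ball" assume "p \<noteq> q"
  then have "Rep_dual_ball p \<noteq> Rep_dual_ball q"
    by (simp add: Rep_dual_ball_inject)
  then obtain f where f: "Rep_dual_ball p f \<noteq> Rep_dual_ball q f"
    by auto
  then obtain U V where UV: "open U" "open V" "Rep_dual_ball p f \<in> U" "Rep_dual_ball q f \<in> V"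
      "U \<inter> V = {}"
    using hausdorff[OF f] by blast
  have "open (Rep_dual_ball -` ((\<lambda>h. h f) -` W))" if "open W" for W
    unfolding open_dual_ball_def
    by (intro exI[of _ "(\<lambda>h. h f) -` W"] conjI refl
        open_vimage[OF that continuous_on_product_coordinates])
  with UV show "\<exists>U V. open U \<and> open V \<and> p \<in> U \<and> q \<in> V \<and> U \<inter> V = {}"
    by (intro exI[of _ "Rep_dual_ball -` ((\<lambda>h. h f) -` U)"]
        exI[of _ "Rep_dual_ball -` ((\<lambda>h. h f) -` V)"]) auto
qed

lemma dual_ball_set_eq:
  "{\<phi> \<in> bounded_functionals.
      onorm (\<phi> :: ('a::topological_space \<Rightarrow>\<^sub>C 's::real_normed_field) \<Rightarrow> 's) \<le> 1} =
   {\<phi>. (\<forall>f g. \<phi> (f + g) = \<phi> f + \<phi> g) \<and> (\<forall>r f. \<phi> (r *\<^sub>R f) = r *\<^sub>R \<phi> f) \<and>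
      (\<forall>c f. \<phi> (scale_bc c f) = c * \<phi> f) \<and> (\<forall>f. norm (\<phi> f) \<le> norm f)}" (is "?L = ?R")
proof (intro set_eqI iffI)
  fix \<phi> :: "('a \<Rightarrow>\<^sub>C 's) \<Rightarrow> 's"
  assume "\<phi> \<in> ?L"
  then have b: "bounded_linear \<phi>" and o: "onorm \<phi> \<le> 1"
    and c: "\<And>c f. \<phi> (scale_bc c f) = c * \<phi> f"
    by (auto simp: bounded_functionals_def)
  have "norm (\<phi> f) \<le> norm f" for f
    using onorm[OF b, of f] mult_right_mono[OF o norm_ge_zero[of f]] by simp
  with b c show "\<phi> \<in> ?R"
    by (auto simp: linear_simps)
next
  fix \<phi> :: "('a \<Rightarrow>\<^sub>C 's) \<Rightarrow> 's"
  assume R: "\<phi> \<in> ?R"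
  then have "bounded_linear \<phi>"
    by (intro bounded_linear_intro[where K = 1]) auto
  moreover have "onorm \<phi> \<le> 1"
    using R by (intro onorm_bound) auto
  ultimately show "\<phi> \<in> ?L"
    using R by (simp add: bounded_functionals_def)
qed

lemma compact_UNIV_dual_ball:
  "compact (UNIV :: ('a::topological_space, 's::{real_normed_field, heine_borel}) dual_ball set)"
proof (rule compact_UNIV_vimage[OF open_dual_ball_def])
  let ?S = "{\<phi>. (\<forall>f g. \<phi> (f + g) = \<phi> f + \<phi> g) \<and> (\<forall>r f. \<phi> (r *\<^sub>R f) = r *\<^sub>R \<phi> f) \<and>
      (\<forall>c f. \<phi> (scale_bc c f) = c * \<phi> f) \<and> (\<forall>f::'a \<Rightarrow>\<^sub>C 's. norm (\<phi> f :: 's) \<le> norm f)}"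
  have "closed ?S"
    by (intro closed_Collect_conj closed_Collect_all closed_Collect_le closed_Collect_eq
        continuous_on_norm continuous_on_add continuous_on_scaleR continuous_on_mult
        continuous_on_product_coordinates continuous_on_const)
  then have "compact ?S"
    by (rule compact_closed_bounded_fun[where K = "\<lambda>f. cball 0 (norm f)"]) auto
  then show "compact (range (Rep_dual_ball :: ('a, 's) dual_ball \<Rightarrow> _))"
    by (simp add: type_definition.Rep_range[OF type_definition_dual_ball] dual_ball_set_eq)
qed


section \<open>Topological disjoint union\<close>

instantiation sum :: (topological_space, topological_space) topological_space
begin

definition open_sum :: "('a + 'b) set \<Rightarrow> bool"
  where "open_sum U \<longleftrightarrow> open (Inl -` U) \<and> open (Inr -` U)"

instance
  by intro_classes (auto simp: open_sum_def vimage_Union)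

end

lemma open_Inl_image: "open U \<Longrightarrow> open (Inl ` U)"
  and open_Inr_image: "open V \<Longrightarrow> open (Inr ` V)"
proof -
  have *: "Inl -` Inl ` U = U" "Inr -` Inl ` U = {}" "Inr -` Inr ` V = V" "Inl -` Inr ` V = {}"
    for U :: "'u set" and V :: "'v set" by auto
  show "open U \<Longrightarrow> open (Inl ` U)" "open V \<Longrightarrow> open (Inr ` V)"
    by (simp_all add: open_sum_def *)
qed

instance sum :: (t2_space, t2_space) t2_space
proof
  fix x y :: "'a + 'b" assume "x \<noteq> y"
  show "\<exists>U V. open U \<and> open V \<and> x \<in> U \<and> y \<in> V \<and> U \<inter> V = {}"
  proof (cases x; cases y)
    fix a b assume [simp]: "x = Inl a" "y = Inl b"
    with \<open>x \<noteq> y\<close> obtain U V where "open U" "open V" "a \<in> U" "b \<in> V" "U \<inter> V = {}"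
      using separation_t2[of a b] by auto
    then show ?thesis
      by (intro exI[of _ "Inl ` U"] exI[of _ "Inl ` V"]) (auto simp: open_Inl_image)
  next
    fix a b assume [simp]: "x = Inr a" "y = Inr b"
    with \<open>x \<noteq> y\<close> obtain U V where "open U" "open V" "a \<in> U" "b \<in> V" "U \<inter> V = {}"
      using separation_t2[of a b] by auto
    then show ?thesis
      by (intro exI[of _ "Inr ` U"] exI[of _ "Inr ` V"]) (auto simp: open_Inr_image)
  next
    fix a b assume [simp]: "x = Inl a" "y = Inr b"
    show ?thesis
      by (intro exI[of _ "Inl ` UNIV"] exI[of _ "Inr ` UNIV"])
        (auto simp: open_Inl_image open_Inr_image)
  next
    fix a b assume [simp]: "x = Inr a" "y = Inl b"
    show ?thesis
      by (intro exI[of _ "Inr ` UNIV"] exI[of _ "Inl ` UNIV"])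
        (auto simp: open_Inl_image open_Inr_image)
  qed
qed

lemma compact_UNIV_sum:
  assumes "compact (UNIV :: 'a::topological_space set)" "compact (UNIV :: 'b::topological_space set)"
  shows "compact (UNIV :: ('a + 'b) set)"
proof -
  have "continuous_on UNIV (Inl :: 'a \<Rightarrow> 'a + 'b)" "continuous_on UNIV (Inr :: 'b \<Rightarrow> 'a + 'b)"
    by (simp_all add: continuous_on_open_vimage open_sum_def)
  then have "compact (range (Inl :: 'a \<Rightarrow> 'a + 'b) \<union> range (Inr :: 'b \<Rightarrow> 'a + 'b))"
    using assms by (intro compact_Un compact_continuous_image)
  also have "range (Inl :: 'a \<Rightarrow> 'a + 'b) \<union> range (Inr :: 'b \<Rightarrow> 'a + 'b) = UNIV"
    by (simp add: UNIV_sum)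
  finally show ?thesis .
qed


section \<open>The space \<open>K\<close>\<close>

type_synonym beta_nat = "nat stone_cech"

type_synonym 's K_space = "(beta_nat, 's) dual_ball + beta_nat"

lemma compact_UNIV_K_space:
  "compact (UNIV :: ('s::{real_normed_field, heine_borel}) K_space set)"
  by (intro compact_UNIV_sum compact_UNIV_dual_ball compact_UNIV_stone_cech)


section \<open>The Bishop property\<close>

definition supp :: "('a::topological_space \<Rightarrow>\<^sub>C 's::real_normed_field) \<Rightarrow> 'a set"
  where "supp f = closure {t. apply_bcontfun f t \<noteq> 0}"

definition bprec ::
    "('a::topological_space \<Rightarrow>\<^sub>C 's::real_normed_field) \<Rightarrow> ('a \<Rightarrow>\<^sub>C 's) \<Rightarrow> bool"  (infix \<open>\<prec>\<^sub>B\<close> 50)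
  where "f \<prec>\<^sub>B g \<longleftrightarrow> f \<noteq> g \<and> (\<forall>t\<in>supp f. apply_bcontfun f t = apply_bcontfun g t)"

definition bprec_chain :: "('a::topological_space \<Rightarrow>\<^sub>C 's::real_normed_field) set \<Rightarrow> bool"
  where "bprec_chain F \<longleftrightarrow> (\<forall>f\<in>F. \<forall>g\<in>F. f \<noteq> g \<longrightarrow> f \<prec>\<^sub>B g \<or> g \<prec>\<^sub>B f)"

text \<open>
  Only the norm of the codomain matters.  It is not required to be of class \<open>banach\<close>, since the
  library does not provide this instance for \<open>K \<Rightarrow>\<^sub>C 's\<close> with non-metric \<open>K\<close>.
\<close>

definition bishop_property ::
    "(('a::topological_space \<Rightarrow>\<^sub>C 's::real_normed_field) \<Rightarrow> 'x::real_normed_vector) \<Rightarrow> bool"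
  where "bishop_property T \<longleftrightarrow>
    (\<forall>F. bounded F \<and> uncountable F \<and> bprec_chain F \<longrightarrow>
      Inf {norm (T f - T g) | f g. f \<in> F \<and> g \<in> F \<and> f \<prec>\<^sub>B g} = 0)"


section \<open>Right ideals of operator algebras\<close>

definition right_ideal ::
    "(('a::topological_space \<Rightarrow>\<^sub>C 's::real_normed_field) \<Rightarrow> ('a \<Rightarrow>\<^sub>C 's)) set \<Rightarrow>
     (('a \<Rightarrow>\<^sub>C 's) \<Rightarrow> ('a \<Rightarrow>\<^sub>C 's)) set \<Rightarrow> bool"
  where "right_ideal J \<A> \<longleftrightarrow>
    J \<subseteq> \<A> \<and>
    (\<lambda>_. 0) \<in> J \<and>
    (\<forall>S\<in>J. \<forall>T\<in>J. (\<lambda>f. S f + T f) \<in> J) \<and>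
    (\<forall>c. \<forall>T\<in>J. (\<lambda>f. scale_bc c (T f)) \<in> J) \<and>
    (\<forall>T\<in>J. \<forall>R\<in>\<A>. T \<circ> R \<in> J)"

end

(*
  Write C(K) = C(B) + C(beta N).  The projection T onto C(B) has the Bishop property because B,
  being convex, is locally connected: if f precedes g, then {f \<noteq> 0} is relatively clopen in
  {g \<noteq> 0}, so every component of {f \<noteq> 0} is a component of {g \<noteq> 0}.  By compactness only finitely
  many of the (open) components of {f \<noteq> 0} contain a point at which |f| \<ge> \<epsilon>, and if g differs from f
  by at least \<epsilon> somewhere, then g has strictly more such components.  Counting them thus embeds a
  uniformly separated chain into the natural numbers.

  Let R be the operator that sends (f, g) to (the evaluation functional of g on B, 0).  Then
  T \<circ> R = R is isometric on C(beta N), where the clopen closures of the sets {n. q n < r}, for an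
  enumeration q of the rationals and r real, give an uncountable chain of indicator functions at
  mutual distance 1.
*)

theory Submission
  imports Defs
begin

section \<open>Components of cozero sets\<close>

text \<open>Local connectedness makes the components of the open set \<open>?U\<close> open, so they
  cover the compact set where \<open>e \<le> norm (u t)\<close>. Components are pairwise disjoint,
  so a finite subcover already contains each one that meets this set.\<close>

lemma finite_components_reaching:
  fixes u :: "'a::topological_space \<Rightarrow> 'b::real_normed_vector"
  assumes K: "compact (UNIV :: 'a set)" and lc: "locally connected (UNIV :: 'a set)"
    and u: "continuous_on UNIV u" and e: "0 < e"
  shows "finite {C \<in> components {t. u t \<noteq> 0}. \<exists>t\<in>C. e \<le> norm (u t)}" (is "finite ?N")
proof -
  let ?U = "{t. u t \<noteq> 0}"
  have "open ?U"
    using u by (intro open_Collect_neq continuous_on_const)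
  then have op: "open C" if "C \<in> components ?U" for C
    using lc that unfolding locally_connected_open_component by auto
  have "closed {t. e \<le> norm (u t)}"
    using u by (intro closed_Collect_le continuous_on_const continuous_on_norm)
  then have "compact (UNIV \<inter> {t. e \<le> norm (u t)})"
    by (intro compact_Int_closed K)
  moreover have "UNIV \<inter> {t. e \<le> norm (u t)} \<subseteq> \<Union>(components ?U)"
    using e by (auto simp: Union_components [symmetric])
  ultimately obtain D where D: "D \<subseteq> components ?U" "finite D"
      "UNIV \<inter> {t. e \<le> norm (u t)} \<subseteq> \<Union>D"
    using compactE[of _ "components ?U"] op by metis
  have "?N \<subseteq> D"
  proof
    fix C assume "C \<in> ?N"
    then obtain t where C: "C \<in> components ?U" "t \<in> C" "e \<le> norm (u t)"
      by auto
    with D(3) obtain C' where C': "C' \<in> D" "t \<in> C'"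
      by auto
    with C D(1) have "C = C'"
      using components_nonoverlap[of C ?U C'] by auto
    with C' show "C \<in> D" by simp
  qed
  with D(2) show ?thesis
    by (rule finite_subset[rotated])
qed

text \<open>The agreement on the closure makes \<open>?U\<close> relatively clopen in
  \<open>?V\<close>: it is open, and a point of its closure outside \<open>?U\<close> is a zero of
  \<open>v\<close>. A component of \<open>?V\<close> that meets \<open>?U\<close> therefore lies
  inside \<open>?U\<close>.\<close>

lemma components_cozero_mono:
  fixes u v :: "'a::topological_space \<Rightarrow> 'b::real_normed_vector"
  assumes u: "continuous_on UNIV u"
    and agree: "\<And>t. t \<in> closure {t. u t \<noteq> 0} \<Longrightarrow> u t = v t"
  shows "components {t. u t \<noteq> 0} \<subseteq> components {t. v t \<noteq> 0}"
proof
  let ?U = "{t. u t \<noteq> 0}" and ?V = "{t. v t \<noteq> 0}"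
  have UV: "?U \<subseteq> ?V"
  proof
    fix t assume "t \<in> ?U"
    then have "u t = v t"
      by (intro agree subsetD[OF closure_subset])
    with \<open>t \<in> ?U\<close> show "t \<in> ?V"
      by simp
  qed
  have opU: "open ?U"
    using u by (intro open_Collect_neq continuous_on_const)
  fix C assume "C \<in> components ?U"
  then obtain x where x: "x \<in> ?U" "C = connected_component_set ?U x"
    by (auto simp: components_def)
  let ?D = "connected_component_set ?V x"
  have "x \<in> ?D"
    using x(1) UV by (auto intro: connected_component_refl)
  have V: "?D \<subseteq> ?V"
    by (rule connected_component_subset)
  \<comment> \<open>At a boundary point of \<open>?U\<close> both functions vanish, so
    \<open>?D\<close> avoids the boundary and splits between two disjoint open sets.\<close>
  have "?D \<subseteq> ?U \<union> - closure ?U"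
  proof
    fix t assume "t \<in> ?D"
    then have "v t \<noteq> 0"
      using V by blast
    then show "t \<in> ?U \<union> - closure ?U"
      using agree[of t] by auto
  qed
  moreover have "?U \<inter> - closure ?U \<inter> ?D = {}"
    using closure_subset[of ?U] by blast
  moreover have "open (- closure ?U)"
    by (intro open_Compl closed_closure)
  ultimately have "?U \<inter> ?D = {} \<or> - closure ?U \<inter> ?D = {}"
    using connectedD[OF connected_connected_component opU] by blast
  with x(1) \<open>x \<in> ?D\<close> \<open>?D \<subseteq> ?U \<union> - closure ?U\<close> have "?D \<subseteq> ?U"
    by blast
  then have "C = ?D"
    unfolding x(2) using UV by (rule connected_component_intermediate_subset)
  with x(1) UV show "C \<in> components ?V"
    by (auto simp: components_def)
qed

text \<open>Every component counted for \<open>u\<close> is also counted for \<open>v\<close>, by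
  \<open>components_cozero_mono\<close>. The component of \<open>s\<close> in the cozero set of
  \<open>v\<close> is an additional one: \<open>u s = 0\<close>, hence
  \<open>e \<le> norm (v s)\<close>.\<close>

lemma card_components_reaching_less:
  fixes u v :: "'a::topological_space \<Rightarrow> 'b::real_normed_vector"
  assumes K: "compact (UNIV :: 'a set)" and lc: "locally connected (UNIV :: 'a set)"
    and u: "continuous_on UNIV u" and v: "continuous_on UNIV v"
    and agree: "\<And>t. t \<in> closure {t. u t \<noteq> 0} \<Longrightarrow> u t = v t"
    and e: "0 < e" "e \<le> norm (u s - v s)"
  shows "card {C \<in> components {t. u t \<noteq> 0}. \<exists>t\<in>C. e \<le> norm (u t)}
       < card {C \<in> components {t. v t \<noteq> 0}. \<exists>t\<in>C. e \<le> norm (v t)}" (is "card ?M < card ?N")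
proof (rule psubset_card_mono)
  show "finite ?N"
    by (rule finite_components_reaching[OF K lc v e(1)])
  have agree': "u t = v t" if "u t \<noteq> 0" for t
    using agree closure_subset[of "{t. u t \<noteq> 0}"] that by blast
  have us: "u s = 0"
    using agree'[of s] e by (cases "u s = 0") auto
  have "?M \<subseteq> ?N"
  proof
    fix C assume "C \<in> ?M"
    then obtain t where "C \<in> components {t. u t \<noteq> 0}" "t \<in> C" "e \<le> norm (u t)"
      by auto
    moreover from this have "u t = v t"
      using agree'[of t] in_components_subset by blast
    ultimately show "C \<in> ?N"
      using components_cozero_mono[OF u agree] by auto
  qed
  moreover have "connected_component_set {t. v t \<noteq> 0} s \<in> ?N - ?M"
  proof -
    have "v s \<noteq> 0" "e \<le> norm (v s)"
      using us e by auto
    then have "s \<in> connected_component_set {t. v t \<noteq> 0} s"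
      by (auto intro: connected_component_refl)
    moreover have "C \<notin> components {t. u t \<noteq> 0}" if "s \<in> C" for C
      using us that in_components_subset by blast
    ultimately show ?thesis
      using \<open>v s \<noteq> 0\<close> \<open>e \<le> norm (v s)\<close> by (auto simp: components_def intro!: exI[of _ s] connected_component_refl)
  qed
  ultimately show "?M \<subset> ?N"
    by blast
qed


section \<open>Local connectedness of the dual ball\<close>

text \<open>This form by pointwise conditions serves both to read off properties of points of the
  ball and to construct new points: convex combinations and point evaluations.\<close>

lemma Rep_dual_ball_iff:
  "(\<exists>p. Rep_dual_ball p = \<phi>) \<longleftrightarrow>
     (\<forall>f g. \<phi> (f + g) = \<phi> f + \<phi> g) \<and> (\<forall>r f. \<phi> (r *\<^sub>R f) = r *\<^sub>R \<phi> f) \<and>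
     (\<forall>c f. \<phi> (scale_bc c f) = c * \<phi> f) \<and> (\<forall>f. norm (\<phi> f) \<le> norm f)"
proof -
  have "(\<exists>p. Rep_dual_ball p = \<phi>) \<longleftrightarrow> \<phi> \<in> range Rep_dual_ball"
    by auto
  then show ?thesis
    by (simp add: type_definition.Rep_range[OF type_definition_dual_ball] dual_ball_set_eq)
qed

lemma
  shows Rep_dual_ball_add: "Rep_dual_ball p (f + g) = Rep_dual_ball p f + Rep_dual_ball p g"
    and Rep_dual_ball_scaleR: "Rep_dual_ball p (r *\<^sub>R f) = r *\<^sub>R Rep_dual_ball p f"
    and Rep_dual_ball_scale: "Rep_dual_ball p (scale_bc c f) = c * Rep_dual_ball p f"
    and norm_Rep_dual_ball: "norm (Rep_dual_ball p f) \<le> norm f"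
  using Rep_dual_ball_iff[of "Rep_dual_ball p"] by blast+

lemma continuous_Rep_dual_ball: "continuous_on UNIV (\<lambda>p. Rep_dual_ball p f)"
  unfolding continuous_on_open_vimage[OF open_UNIV]
proof (intro allI impI)
  fix W :: "'b set" assume "open W"
  then have "open ((\<lambda>h. h f) -` W)"
    by (rule open_vimage[OF _ continuous_on_product_coordinates])
  then show "open ((\<lambda>p. Rep_dual_ball p f) -` W \<inter> UNIV)"
    unfolding open_dual_ball_def by (intro exI[of _ "(\<lambda>h. h f) -` W"]) auto
qed

lemma continuous_into_dual_ball:
  fixes r :: "'c::topological_space \<Rightarrow> ('a::topological_space, 's::real_normed_field) dual_ball"
  assumes "\<And>f. continuous_on S (\<lambda>x. Rep_dual_ball (r x) f)"
  shows "continuous_on S r"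
  unfolding continuous_on_open_invariant
proof (intro allI impI)
  fix B :: "('a, 's) dual_ball set" assume "open B"
  then obtain V where V: "open V" "B = Rep_dual_ball -` V"
    by (auto simp: open_dual_ball_def)
  have "continuous_on S (\<lambda>x. Rep_dual_ball (r x))"
    using assms by (rule continuous_on_coordinatewise_then_product)
  with V(1) obtain A where "open A" "A \<inter> S = (\<lambda>x. Rep_dual_ball (r x)) -` V \<inter> S"
    unfolding continuous_on_open_invariant by blast
  with V(2) show "\<exists>A. open A \<and> A \<inter> S = r -` B \<inter> S"
    by auto
qed

text \<open>The segment between two points of the set stays in the ball and in every convex
  \<open>Y f\<close>, and it is weak* continuous because each of its coordinates is.\<close>

lemma connected_vimage_convex_box:
  fixes Y :: "('a::topological_space \<Rightarrow>\<^sub>C 's::real_normed_field) \<Rightarrow> 's set"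
  assumes "\<And>f. convex (Y f)"
  shows "connected {p. \<forall>f. Rep_dual_ball p f \<in> Y f}" (is "connected ?W")
  unfolding connected_iff_connected_component
proof (intro ballI)
  fix p q assume pq: "p \<in> ?W" "q \<in> ?W"
  define \<gamma> where "\<gamma> t f = (1 - t) *\<^sub>R Rep_dual_ball p f + t *\<^sub>R Rep_dual_ball q f" for t f
  have "\<exists>x. Rep_dual_ball x = \<gamma> t" if t: "t \<in> {0..1}" for t
    unfolding Rep_dual_ball_iff
  proof (intro conjI allI)
    fix f
    have "norm (\<gamma> t f) \<le> norm ((1 - t) *\<^sub>R Rep_dual_ball p f) + norm (t *\<^sub>R Rep_dual_ball q f)"
      unfolding \<gamma>_def by (rule norm_triangle_ineq)
    also have "\<dots> \<le> (1 - t) * norm f + t * norm f"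
      using t by (auto intro!: add_mono mult_left_mono norm_Rep_dual_ball)
    finally show "norm (\<gamma> t f) \<le> norm f"
      by (simp add: algebra_simps)
  qed (simp_all add: \<gamma>_def Rep_dual_ball_add Rep_dual_ball_scaleR Rep_dual_ball_scale algebra_simps)
  \<comment> \<open>The segment is formed among functionals; \<open>c\<close> lifts it to a path in
    the type of the ball.\<close>
  then obtain c where c: "\<And>t. t \<in> {0..1} \<Longrightarrow> Rep_dual_ball (c t) = \<gamma> t"
    by metis
  have "continuous_on {0..1} c"
  proof (rule continuous_into_dual_ball)
    show "continuous_on {0..1} (\<lambda>t. Rep_dual_ball (c t) f)" for f
      by (subst continuous_on_cong[OF refl fun_cong[OF c]])
        (auto simp: \<gamma>_def intro!: continuous_intros)
  qed
  then have "connected (c ` {0..1})"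
    by (rule connected_continuous_image) simp
  moreover have "c ` {0..1} \<subseteq> ?W"
    using pq assms by (auto simp: c \<gamma>_def intro!: convexD)
  moreover have "c 0 = p" "c 1 = q"
    by (simp_all add: c \<gamma>_def fun_eq_iff flip: Rep_dual_ball_inject)
  then have "p \<in> c ` {0..1}" "q \<in> c ` {0..1}"
    by (auto simp: image_iff intro: bexI[of _ 0] bexI[of _ 1])
  ultimately show "connected_component ?W p q"
    unfolding connected_component_def by blast
qed

text \<open>A basic neighbourhood restricts finitely many coordinates. Shrinking each of these to a
  ball gives a box with convex sides, whose trace on the dual ball is connected.\<close>

lemma locally_connected_dual_ball:
  "locally connected (UNIV :: ('a::topological_space, 's::real_normed_field) dual_ball set)"
proof (rule locally_connected_1)
  fix V :: "('a, 's) dual_ball set" and p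
  assume "openin (top_of_set UNIV) V" "p \<in> V"
  then obtain V' where V': "open V'" "V = Rep_dual_ball -` V'" "Rep_dual_ball p \<in> V'"
    by (auto simp: open_dual_ball_def)
  then have "openin (product_topology (\<lambda>_. euclidean) UNIV) V'"
    by (simp add: open_fun_def)
  from product_topology_open_contains_basis[OF this V'(3)]
  obtain X where X: "\<And>f. Rep_dual_ball p f \<in> X f" "\<And>f. open (X f)" "finite {f. X f \<noteq> UNIV}"
      "PiE UNIV X \<subseteq> V'"
    by (auto simp: PiE_UNIV_domain Pi_iff)
  have "\<exists>e>0. ball (Rep_dual_ball p f) e \<subseteq> X f" for f
    using X(1,2) by (meson open_contains_ball)
  then obtain e where e: "\<And>f. e f > 0" "\<And>f. ball (Rep_dual_ball p f) (e f) \<subseteq> X f"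
    by metis
  \<comment> \<open>Unrestricted coordinates keep \<open>UNIV\<close>, so that \<open>?W\<close> is
    a finite intersection of open sets.\<close>
  define Y where "Y f = (if X f = UNIV then UNIV else ball (Rep_dual_ball p f) (e f))" for f
  let ?W = "{q. \<forall>f. Rep_dual_ball q f \<in> Y f}"
  have "?W = (\<Inter>f\<in>{f. X f \<noteq> UNIV}. (\<lambda>q. Rep_dual_ball q f) -` ball (Rep_dual_ball p f) (e f))"
    by (auto simp: Y_def)
  moreover have "open \<dots>"
    using X(3) by (intro open_INT ballI open_vimage open_ball continuous_Rep_dual_ball)
  ultimately have "open ?W"
    by simp
  moreover have "connected ?W"
    by (intro connected_vimage_convex_box) (simp add: Y_def)
  moreover have "p \<in> ?W"
    using e(1) by (simp add: Y_def)
  moreover have "?W \<subseteq> V"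
    using X(4) e(2) unfolding V'(2) by (fastforce simp: Y_def PiE_UNIV_domain split: if_splits)
  ultimately show "\<exists>U. openin (top_of_set UNIV) U \<and> connected U \<and> p \<in> U \<and> U \<subseteq> V"
    by auto
qed


section \<open>The two operators\<close>

lemma continuous_case_sum:
  assumes "continuous_on UNIV u" "continuous_on UNIV v"
  shows "continuous_on UNIV (case_sum u v)"
  using assms by (simp add: continuous_on_open_vimage open_sum_def vimage_def)

lemma continuous_Inl: "continuous_on UNIV Inl"
  and continuous_Inr: "continuous_on UNIV Inr"
  by (simp_all add: continuous_on_open_vimage open_sum_def)

lemma
  fixes h :: "('a::topological_space + 'b::topological_space) \<Rightarrow>\<^sub>C 's::real_normed_vector"
  shows continuous_apply_Inl: "continuous_on UNIV (\<lambda>x. h (Inl x))"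
    and continuous_apply_Inr: "continuous_on UNIV (\<lambda>y. h (Inr y))"
  by (auto intro: continuous_on_compose2[of UNIV "apply_bcontfun h"] continuous_Inl continuous_Inr)

section \<open>The projection onto the first summand\<close>

definition left_part :: "(('a + 'b) \<Rightarrow>\<^sub>C 's) \<Rightarrow> (('a::topological_space + 'b::topological_space) \<Rightarrow>\<^sub>C 's::real_normed_field)"
  where "left_part h = Bcontfun (case_sum (\<lambda>x. h (Inl x)) (\<lambda>_. 0))"

lemma apply_left_part [simp]:
  fixes h :: "('a::topological_space + 'b::topological_space) \<Rightarrow>\<^sub>C 's::real_normed_field"
  shows "left_part h (Inl x) = h (Inl x)" "left_part h (Inr y) = 0"
proof -
  have "(case_sum (\<lambda>x. h (Inl x)) (\<lambda>_. 0) :: 'a + 'b \<Rightarrow> 's) \<in> bcontfun"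
    by (rule bcontfun_normI[where b = "norm h"])
      (auto simp: norm_bounded continuous_apply_Inl intro!: continuous_case_sum split: sum.split)
  then show "left_part h (Inl x) = h (Inl x)" "left_part h (Inr y) = 0"
    by (simp_all add: left_part_def Bcontfun_inverse)
qed

lemma bounded_operatorI:
  fixes T :: "('a::topological_space \<Rightarrow>\<^sub>C 's::real_normed_field) \<Rightarrow> ('a \<Rightarrow>\<^sub>C 's)"
  assumes "\<And>f g x. T (f + g) x = T f x + T g x" "\<And>r f x. T (r *\<^sub>R f) x = r *\<^sub>R T f x"
    "\<And>c f x. T (scale_bc c f) x = c * T f x" "\<And>f x. norm (T f x) \<le> norm f"
  shows "T \<in> bounded_operators"
proof -
  have "bounded_linear T"
    using assms by (intro bounded_linear_intro[where K = 1]) (auto intro!: bcontfun_eqI norm_bound)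
  moreover have "T (scale_bc c f) = scale_bc c (T f)" for c f
    using assms by (intro bcontfun_eqI) simp
  ultimately show ?thesis
    by (simp add: bounded_operators_def)
qed

lemma left_part_bounded_operator: "left_part \<in> bounded_operators"
proof (rule bounded_operatorI)
  fix f g :: "('a::topological_space + 'b::topological_space) \<Rightarrow>\<^sub>C 's::real_normed_field" and r c x
  show "left_part (f + g) x = left_part f x + left_part g x"
    "left_part (r *\<^sub>R f) x = r *\<^sub>R left_part f x"
    "left_part (scale_bc c f) x = c * left_part f x"
    "norm (left_part f x) \<le> norm f"
    by (cases x; simp add: norm_bounded)+
qed

text \<open>If the infimum were positive, the number of components reaching height \<open>e\<close>
  would strictly increase along the chain. This would inject the chain into the natural numbers and
  make it countable.\<close>

lemma bishop_property_left_part: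
  assumes K: "compact (UNIV :: 'a::topological_space set)"
    and lc: "locally connected (UNIV :: 'a set)"
  shows "bishop_property (left_part :: (('a + 'b::topological_space) \<Rightarrow>\<^sub>C 's::real_normed_field) \<Rightarrow> _)"
  unfolding bishop_property_def
proof (intro allI impI)
  fix F :: "(('a + 'b) \<Rightarrow>\<^sub>C 's) set"
  assume F: "bounded F \<and> uncountable F \<and> bprec_chain F"
  let ?D = "{norm (left_part f - left_part g) | f g. f \<in> F \<and> g \<in> F \<and> f \<prec>\<^sub>B g}"
  have bdd: "bdd_below ?D"
    by (rule bdd_belowI[of _ 0]) auto
  have chain: "f \<prec>\<^sub>B g \<or> g \<prec>\<^sub>B f" if "f \<in> F" "g \<in> F" "f \<noteq> g" for f g
    using F that by (auto simp: bprec_chain_def)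
  have "infinite F"
    using F by (simp add: uncountable_infinite)
  then obtain f where "f \<in> F"
    by (metis finite.emptyI ex_in_conv)
  moreover obtain g where "g \<in> F" "f \<noteq> g"
    using \<open>infinite F\<close> by (metis finite.emptyI finite.insertI finite_subset singletonI subsetI)
  ultimately
  \<comment> \<open>The infimum of an empty set of reals is unspecified, so a comparable pair is
    exhibited first.\<close>
  have "?D \<noteq> {}"
    using chain[of f g] by blast
  show "Inf ?D = 0"
  proof (rule ccontr)
    assume "Inf ?D \<noteq> 0"
    moreover have "0 \<le> Inf ?D"
      using \<open>?D \<noteq> {}\<close> by (intro cInf_greatest) auto
    ultimately have pos: "0 < Inf ?D"
      by simp
    \<comment> \<open>Halving makes the norms strictly larger than \<open>e\<close>, which yields an
      actual point where the difference exceeds \<open>e\<close>.\<close>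
    define e where "e = Inf ?D / 2"
    have e: "0 < e"
      using pos by (simp add: e_def)
    define N where "N h = card {C \<in> components {t. h (Inl t) \<noteq> 0}. \<exists>t\<in>C. e \<le> norm (h (Inl t))}"
      for h :: "('a + 'b) \<Rightarrow>\<^sub>C 's"
    have less: "N f < N g" if fg: "f \<in> F" "g \<in> F" "f \<prec>\<^sub>B g" for f g
    proof -
      have "Inf ?D \<le> norm (left_part f - left_part g)"
        using fg by (intro cInf_lower[OF _ bdd]) blast
      with pos have "e < norm (left_part f - left_part g)"
        by (simp add: e_def)
      then obtain z where z: "e < norm (left_part f z - left_part g z)"
        using norm_bound[of "left_part f - left_part g" e] by (metis minus_bcontfun.rep_eq not_less)
      \<comment> \<open>The point \<open>z\<close> cannot lie in the second summand, where both
        images vanish.\<close>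
      then obtain s where s: "e \<le> norm (f (Inl s) - g (Inl s))"
        using e by (cases z) (auto intro: less_imp_le)
      have "closed (Inl -` supp f)"
        unfolding supp_def by (intro closed_vimage closed_closure continuous_Inl)
      moreover have "{t. f (Inl t) \<noteq> 0} \<subseteq> Inl -` supp f"
        using closure_subset by (fastforce simp: supp_def)
      ultimately have "closure {t. f (Inl t) \<noteq> 0} \<subseteq> Inl -` supp f"
        by (rule closure_minimal[rotated])
      then have "f (Inl t) = g (Inl t)" if "t \<in> closure {t. f (Inl t) \<noteq> 0}" for t
        using fg(3) that by (auto simp: bprec_def)
      then show ?thesis
        unfolding N_def
        by (rule card_components_reaching_less[OF K lc continuous_apply_Inl continuous_apply_Inl _ e s])
    qed
    have "inj_on N F"
      using chain less by (intro inj_onI) (metis less_irrefl)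
    then have "countable F"
      by (rule countableI)
    with F show False
      by simp
  qed
qed

section \<open>The embedding of the second summand by evaluation functionals\<close>

definition right_part :: "(('a::topological_space + 'b::topological_space) \<Rightarrow>\<^sub>C 's) \<Rightarrow> ('b \<Rightarrow>\<^sub>C 's::real_normed_field)"
  where "right_part h = Bcontfun (\<lambda>y. h (Inr y))"

lemma apply_right_part [simp]: "right_part h y = h (Inr y)"
proof -
  have "(\<lambda>y. h (Inr y)) \<in> bcontfun"
    by (rule bcontfun_normI[where b = "norm h"]) (auto simp: norm_bounded continuous_apply_Inr)
  then show ?thesis
    by (simp add: right_part_def Bcontfun_inverse)
qed

definition dual_embed ::
    "((('b, 's) dual_ball + 'b) \<Rightarrow>\<^sub>C 's) \<Rightarrow> ((('b::topological_space, 's::real_normed_field) dual_ball + 'b) \<Rightarrow>\<^sub>C 's)"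
  where "dual_embed h = Bcontfun (case_sum (\<lambda>\<phi>. Rep_dual_ball \<phi> (right_part h)) (\<lambda>_. 0))"

lemma norm_right_part: "norm (right_part h) \<le> norm h"
  by (rule norm_bound) (simp add: norm_bounded)

lemma norm_Rep_right_part: "norm (Rep_dual_ball \<phi> (right_part h)) \<le> norm h"
  using norm_Rep_dual_ball norm_right_part by (rule order_trans)

lemma apply_dual_embed [simp]:
  fixes h :: "(('b::topological_space, 's::real_normed_field) dual_ball + 'b) \<Rightarrow>\<^sub>C 's"
  shows "dual_embed h (Inl \<phi>) = Rep_dual_ball \<phi> (right_part h)" "dual_embed h (Inr y) = 0"
proof -
  have "(case_sum (\<lambda>\<phi>. Rep_dual_ball \<phi> (right_part h)) (\<lambda>_. 0) :: ('b, 's) dual_ball + 'b \<Rightarrow> 's) \<in> bcontfun"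
    by (rule bcontfun_normI[where b = "norm h"])
      (auto simp: norm_Rep_right_part continuous_Rep_dual_ball intro!: continuous_case_sum split: sum.split)
  then show "dual_embed h (Inl \<phi>) = Rep_dual_ball \<phi> (right_part h)" "dual_embed h (Inr y) = 0"
    by (simp_all add: dual_embed_def Bcontfun_inverse)
qed

lemma dual_embed_bounded_operator:
  "(dual_embed :: ((('b::topological_space, 's::real_normed_field) dual_ball + 'b) \<Rightarrow>\<^sub>C 's) \<Rightarrow> _) \<in> bounded_operators"
proof (rule bounded_operatorI)
  fix f g :: "(('b, 's) dual_ball + 'b) \<Rightarrow>\<^sub>C 's" and r c x
  have "right_part (f + g) = right_part f + right_part g"
    "right_part (r *\<^sub>R f) = r *\<^sub>R right_part f"
    "right_part (scale_bc c f) = scale_bc c (right_part f)"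
    by (rule bcontfun_eqI; simp)+
  then show "dual_embed (f + g) x = dual_embed f x + dual_embed g x"
    "dual_embed (r *\<^sub>R f) x = r *\<^sub>R dual_embed f x"
    "dual_embed (scale_bc c f) x = c * dual_embed f x"
    "norm (dual_embed f x) \<le> norm f"
    by (cases x; simp add: norm_Rep_right_part Rep_dual_ball_add Rep_dual_ball_scaleR Rep_dual_ball_scale)+
qed

text \<open>The values of \<open>dual_embed\<close> already vanish on the second summand, so the
  projection leaves them unchanged.\<close>

lemma left_part_dual_embed:
  "left_part \<circ> dual_embed =
    (dual_embed :: ((('b::topological_space, 's::real_normed_field) dual_ball + 'b) \<Rightarrow>\<^sub>C 's) \<Rightarrow> _)"
proof
  show "(left_part \<circ> dual_embed) h = dual_embed h" for h :: "(('b, 's) dual_ball + 'b) \<Rightarrow>\<^sub>C 's"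
  proof (rule bcontfun_eqI)
    show "(left_part \<circ> dual_embed) h x = dual_embed h x" for x
      by (cases x) simp_all
  qed
qed

text \<open>Evaluation at \<open>y\<close> is itself a point of the dual ball, and the embedded
  functions take there their original values at \<open>y\<close>.\<close>

lemma norm_le_dual_embed:
  fixes h k :: "(('b::topological_space, 's::real_normed_field) dual_ball + 'b) \<Rightarrow>\<^sub>C 's"
  shows "norm (h (Inr y) - k (Inr y)) \<le> norm (dual_embed h - dual_embed k)"
proof -
  obtain \<delta> where \<delta>: "Rep_dual_ball \<delta> = (\<lambda>f::'b \<Rightarrow>\<^sub>C 's. f y)"
    using Rep_dual_ball_iff[of "\<lambda>f::'b \<Rightarrow>\<^sub>C 's. f y"] by (auto simp: norm_bounded)
  show ?thesis
    using norm_bounded[of "dual_embed h - dual_embed k" "Inl \<delta>"] by (simp add: \<delta>)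
qed


section \<open>An uncountable chain of indicator functions\<close>

lemma continuous_Rep_stone_cech: "continuous_on UNIV (\<lambda>p. Rep_stone_cech p f)"
  unfolding continuous_on_open_vimage[OF open_UNIV]
proof (intro allI impI)
  fix W :: "real set" assume "open W"
  then have "open ((\<lambda>h. h f) -` W)"
    by (rule open_vimage[OF _ continuous_on_product_coordinates])
  then show "open ((\<lambda>p. Rep_stone_cech p f) -` W \<inter> UNIV)"
    unfolding open_stone_cech_def by (intro exI[of _ "(\<lambda>h. h f) -` W"]) auto
qed

text \<open>The canonical image is dense, so a closed condition need only be checked on the original
  points.\<close>

lemma Rep_stone_cech_in_closed:
  assumes "closed C" "\<And>x. (\<lambda>f. apply_bcontfun f x) \<in> C"
  shows "Rep_stone_cech p \<in> C"
proof -
  have "closure (range (\<lambda>x. \<lambda>f. apply_bcontfun f x)) \<subseteq> C"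
    using assms by (intro closure_minimal) auto
  with Rep_stone_cech[of p] show ?thesis
    by blast
qed

lemma stone_cech_point: obtains p where "Rep_stone_cech p = (\<lambda>f. apply_bcontfun f x)"
proof -
  have "(\<lambda>f. apply_bcontfun f x) \<in> closure (range (\<lambda>x. \<lambda>f. apply_bcontfun f x))"
    by (rule subsetD[OF closure_subset]) (rule rangeI)
  then show ?thesis
    by (intro that[of "Abs_stone_cech (\<lambda>f. apply_bcontfun f x)"] Abs_stone_cech_inverse)
qed

text \<open>These are indicators of the lower cuts of an enumeration of the rationals: an increasing
  family of sets of naturals indexed by the reals.\<close>

definition cut_indicator :: "real \<Rightarrow> (nat \<Rightarrow>\<^sub>C real)"
  where "cut_indicator r = Bcontfun (\<lambda>n. if real_of_rat (nat_to_rat_surj n) < r then 1 else 0)"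

lemma apply_cut_indicator [simp]:
  "cut_indicator r n = (if real_of_rat (nat_to_rat_surj n) < r then 1 else 0)"
proof -
  have "(\<lambda>n. if real_of_rat (nat_to_rat_surj n) < r then 1 else 0 :: real) \<in> bcontfun"
    by (rule bcontfun_normI[where b = 1]) auto
  then show ?thesis
    by (simp add: cut_indicator_def Bcontfun_inverse)
qed

lemma Rep_stone_cech_cut: "Rep_stone_cech p (cut_indicator r) \<in> {0, 1}"
proof -
  have "closed ((\<lambda>h. h (cut_indicator r)) -` {0, 1 :: real})"
    by (intro closed_vimage continuous_on_product_coordinates) auto
  from Rep_stone_cech_in_closed[OF this, of p] show ?thesis
    by simp
qed

lemma Rep_stone_cech_cut_mono:
  assumes "r \<le> s"
  shows "Rep_stone_cech p (cut_indicator r) \<le> Rep_stone_cech p (cut_indicator s)"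
proof -
  have "closed {h. h (cut_indicator r) \<le> (h (cut_indicator s) :: real)}"
    by (intro closed_Collect_le continuous_on_product_coordinates)
  from Rep_stone_cech_in_closed[OF this, of p] show ?thesis
    using assms by auto
qed

definition cut_fun :: "real \<Rightarrow> (('a::topological_space + beta_nat) \<Rightarrow>\<^sub>C 's::real_normed_field)"
  where "cut_fun r =
    Bcontfun (case_sum (\<lambda>_. 0) (\<lambda>p. of_real (Rep_stone_cech p (cut_indicator r))))"

lemma apply_cut_fun [simp]:
  fixes x :: "'a::topological_space"
  shows "cut_fun r (Inl x) = (0 :: 's::real_normed_field)"
    and "cut_fun r (Inr p :: 'a + beta_nat) = (of_real (Rep_stone_cech p (cut_indicator r)) :: 's)"
proof -
  let ?u = "case_sum (\<lambda>_. 0) (\<lambda>p. of_real (Rep_stone_cech p (cut_indicator r))) :: 'a + beta_nat \<Rightarrow> 's"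
  have "?u \<in> bcontfun"
  proof (rule bcontfun_normI)
    show "continuous_on UNIV ?u"
      by (intro continuous_case_sum continuous_on_of_real continuous_Rep_stone_cech continuous_on_const)
    show "norm (?u x) \<le> 1" for x
      \<comment> \<open>On the first summand \<open>projr x\<close> is arbitrary, but there the
        function is 0.\<close>
      using Rep_stone_cech_cut[of "projr x" r] by (cases x) auto
  qed
  then show "cut_fun r (Inl x) = (0 :: 's)"
    and "cut_fun r (Inr p :: 'a + beta_nat) = (of_real (Rep_stone_cech p (cut_indicator r)) :: 's)"
    by (simp_all add: cut_fun_def Bcontfun_inverse)
qed

lemma norm_cut_fun:
  "norm (cut_fun r :: ('a::topological_space + beta_nat) \<Rightarrow>\<^sub>C 's::real_normed_field) \<le> 1"
proof (rule norm_bound)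
  show "norm (cut_fun r x :: 's) \<le> 1" for x :: "'a + beta_nat"
    using Rep_stone_cech_cut[of "projr x" r] by (cases x) auto
qed

text \<open>The point is the index of a rational between \<open>r\<close> and \<open>s\<close>,
  viewed in the compactification.\<close>

lemma cut_fun_apart:
  assumes "r < s"
  obtains p where "cut_fun r (Inr p) = 0" "cut_fun s (Inr p) = 1"
proof -
  obtain q where q: "r < real_of_rat q" "real_of_rat q < s"
    using of_rat_dense[OF assms] by blast
  obtain n where n: "nat_to_rat_surj n = q"
    using surj_nat_to_rat_surj by (metis surjD)
  obtain p where "Rep_stone_cech p = (\<lambda>f. apply_bcontfun f n)"
    by (rule stone_cech_point)
  with q n show ?thesis
    by (intro that[of p]) auto
qed

text \<open>The values are 0 or 1 and increase with the cut, so both functions equal 1 wherever the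
  smaller is nonzero. The set of agreement is closed and hence contains the support.\<close>

lemma cut_fun_bprec:
  assumes "r < s"
  shows "cut_fun r \<prec>\<^sub>B (cut_fun s :: ('a::topological_space + beta_nat) \<Rightarrow>\<^sub>C 's::real_normed_field)"
    (is "?f \<prec>\<^sub>B ?g")
  unfolding bprec_def
proof (intro conjI ballI)
  show "?f \<noteq> ?g"
    using cut_fun_apart[OF assms] by (metis zero_neq_one)
  have "closed {t. ?f t = ?g t}"
    by (intro closed_Collect_eq continuous_on_apply_bcontfun)
  moreover have "{t. ?f t \<noteq> 0} \<subseteq> {t. ?f t = ?g t}"
  proof clarify
    fix t assume nz: "?f t \<noteq> 0"
    show "?f t = ?g t"
    proof (cases t)
      case (Inr p)
      then show ?thesis
        using nz Rep_stone_cech_cut[of p r] Rep_stone_cech_cut[of p s]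
          Rep_stone_cech_cut_mono[of r s p] assms by auto
    qed simp
  qed
  ultimately have "supp ?f \<subseteq> {t. ?f t = ?g t}"
    unfolding supp_def by (rule closure_minimal[rotated])
  then show "?f t = ?g t" if "t \<in> supp ?f" for t
    using that by blast
qed

text \<open>The functions \<open>cut_fun r\<close> form a bounded uncountable chain. Any two of them
  differ by exactly 1 at some point of the second summand, and \<open>dual_embed\<close> does not
  shrink this difference, so the infimum is at least 1.\<close>

lemma not_bishop_property_dual_embed:
  "\<not> bishop_property
      (dual_embed :: (((beta_nat, 's::real_normed_field) dual_ball + beta_nat) \<Rightarrow>\<^sub>C 's) \<Rightarrow> _)"
proof
  let ?c = "cut_fun :: real \<Rightarrow> ((beta_nat, 's) dual_ball + beta_nat) \<Rightarrow>\<^sub>C 's"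
  let ?F = "range ?c"
  let ?D = "{norm (dual_embed f - dual_embed g) | f g. f \<in> ?F \<and> g \<in> ?F \<and> f \<prec>\<^sub>B g}"
  assume bishop: "bishop_property
      (dual_embed :: (((beta_nat, 's) dual_ball + beta_nat) \<Rightarrow>\<^sub>C 's) \<Rightarrow> _)"
  have prec: "?c r \<prec>\<^sub>B ?c s" if "r < s" for r s
    using that by (rule cut_fun_bprec)
  have "bounded ?F"
    using norm_cut_fun by (auto simp: bounded_iff)
  moreover have "inj ?c"
  proof (rule linorder_injI)
    show "?c r \<noteq> ?c s" if "r < s" for r s
      using prec[OF that] by (simp add: bprec_def)
  qed
  then have "uncountable ?F"
    using uncountable_UNIV_real by (simp add: countable_image_inj_eq)
  moreover have "bprec_chain ?F"
    unfolding bprec_chain_def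
  proof clarify
    fix r s assume "?c r \<noteq> ?c s" "\<not> ?c s \<prec>\<^sub>B ?c r"
    then show "?c r \<prec>\<^sub>B ?c s"
      using prec[of r s] prec[of s r] by (cases r s rule: linorder_cases) auto
  qed
  ultimately have "Inf ?D = 0"
    using bishop unfolding bishop_property_def by (elim allE[of _ ?F]) (elim impE, simp_all)
  moreover have "1 \<le> Inf ?D"
  proof (rule cInf_greatest)
    show "?D \<noteq> {}"
      using prec[of 0 1] by auto
    fix d assume "d \<in> ?D"
    then obtain f g where "f \<in> ?F" "g \<in> ?F" and fg: "f \<prec>\<^sub>B g" "d = norm (dual_embed f - dual_embed g)"
      by blast
    then obtain r s where rs: "f = ?c r" "g = ?c s"
      by blast
    with fg(1) have "r \<noteq> s"
      by (auto simp: bprec_def)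
    \<comment> \<open>Only \<open>r \<noteq> s\<close> has been extracted from
      \<open>f \<prec>\<^sub>B g\<close>; the norm is symmetric, so both orders of \<open>r\<close>
      and \<open>s\<close> are treated alike.\<close>
    have "\<exists>p. norm (?c r (Inr p) - ?c s (Inr p)) = 1"
    proof (cases "r < s")
      case True
      then obtain p where "?c r (Inr p) = 0" "?c s (Inr p) = 1"
        by (rule cut_fun_apart)
      then show ?thesis
        by (intro exI[of _ p]) simp
    next
      case False
      with \<open>r \<noteq> s\<close> have "s < r"
        by simp
      then obtain p where "?c s (Inr p) = 0" "?c r (Inr p) = 1"
        by (rule cut_fun_apart)
      then show ?thesis
        by (intro exI[of _ p]) simp
    qed
    then show "1 \<le> d"
      unfolding fg(2) rs using norm_le_dual_embed by metis
  qed
  ultimately show False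
    by simp
qed

text \<open>Closure under composition on the right fails: \<open>left_part\<close> belongs to the
  set, but \<open>left_part \<circ> dual_embed = dual_embed\<close> does not. The scalars stay
  generic to cover the real and the complex case at once; \<open>heine_borel\<close> gives the
  compactness of the dual ball.\<close>

lemma not_right_ideal_bishop:
  "\<not> right_ideal
       {T \<in> bounded_operators. bishop_property
          (T :: ('s::{real_normed_field, heine_borel} K_space \<Rightarrow>\<^sub>C 's) \<Rightarrow> ('s K_space \<Rightarrow>\<^sub>C 's))}
       bounded_operators"
proof
  let ?J = "{T \<in> bounded_operators. bishop_property (T :: ('s K_space \<Rightarrow>\<^sub>C 's) \<Rightarrow> ('s K_space \<Rightarrow>\<^sub>C 's))}"
  assume "right_ideal ?J bounded_operators"
  moreover have "left_part \<in> ?J"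
    using bishop_property_left_part[OF compact_UNIV_dual_ball locally_connected_dual_ball]
    by (simp add: left_part_bounded_operator)
  ultimately have "left_part \<circ> dual_embed \<in> ?J"
    unfolding right_ideal_def using dual_embed_bounded_operator by blast
  then show False
    by (simp add: left_part_dual_embed not_bishop_property_dual_embed)
qed

theorem mainTheorem4:
  shows "\<not> right_ideal
           {T \<in> bounded_operators. bishop_property (T :: (real K_space \<Rightarrow>\<^sub>C real) \<Rightarrow> (real K_space \<Rightarrow>\<^sub>C real))}
           bounded_operators \<and>
         \<not> right_ideal
           {T \<in> bounded_operators. bishop_property (T :: (complex K_space \<Rightarrow>\<^sub>C complex) \<Rightarrow> (complex K_space \<Rightarrow>\<^sub>C complex))}
           bounded_operators"
  by (intro conjI not_right_ideal_bishop)

end
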